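(* Let $k$ be a field of characteristic $p>0$ and let $A_1,\ldots,A_n\in k[t]$ be coprime monic polynomials. Then, for any monic polynomial $F\in k[t]$, the equation $$x_1A_1+\cdots+x_nA_n=F$$ has solutions $(x_1,\ldots,x_n)$ with all $x_i\in k[t]_{\geq0}$ of arbitrarily large degree if and only if $n\geq p$.
   Context: $k[t]_{\geq 0}$ denotes the set consisting of all monic polynomials in $k[t]$ together with the zero polynomial. *)

theory Defs
  imports "HOL-Computational_Algebra.Computational_Algebra"
begin

definition monic :: "'a::field poly \<Rightarrow> bool" where
  "monic f \<longleftrightarrow> lead_coeff f = 1"

definition nonneg_polys :: "'a::field poly set" where
  "nonneg_polys = {f. monic f \<or> f = 0}"

(* Joint (not pairwise) coprimality of A 1, ..., A n, as in the Frobenius problem.  It is spelled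
   out because the library's Gcd on polynomials is not available over an arbitrary field type. *)
definition coprime_family :: "nat \<Rightarrow> (nat \<Rightarrow> 'a::field poly) \<Rightarrow> bool" where
  "coprime_family n A \<longleftrightarrow> (\<forall>d. (\<forall>i\<in>{1..n}. d dvd A i) \<longrightarrow> is_unit d)"

definition solution ::
    "nat \<Rightarrow> (nat \<Rightarrow> 'a::field poly) \<Rightarrow> 'a poly \<Rightarrow> (nat \<Rightarrow> 'a poly) \<Rightarrow> bool" where
  "solution n A F x \<longleftrightarrow>
     (\<forall>i\<in>{1..n}. x i \<in> nonneg_polys) \<and> (\<Sum>i=1..n. x i * A i) = F"

(* "Solutions with all x_i nonnegative of arbitrarily large degree" may mean that every x_i has
   large degree, or that the solution has large degree, i.e. the maximum of the degrees of the
   x_i is large.  As degree 0 = 0, zero entries do not satisfy the bound once N > 0. *)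
definition arbitrarily_large_all ::
    "nat \<Rightarrow> (nat \<Rightarrow> 'a::field poly) \<Rightarrow> 'a poly \<Rightarrow> bool" where
  "arbitrarily_large_all n A F \<longleftrightarrow>
     (\<forall>N. \<exists>x. solution n A F x \<and> (\<forall>i\<in>{1..n}. degree (x i) \<ge> N))"

definition arbitrarily_large_max ::
    "nat \<Rightarrow> (nat \<Rightarrow> 'a::field poly) \<Rightarrow> 'a poly \<Rightarrow> bool" where
  "arbitrarily_large_max n A F \<longleftrightarrow>
     (\<forall>N. \<exists>x. solution n A F x \<and> (\<exists>i\<in>{1..n}. degree (x i) \<ge> N))"

end

theory Submission
  imports Defs
begin

text \<open>
  If $n < p$, let $M$ be the maximal degree of the $x_i A_i$. The coefficient of $t^M$ in their sum
  is the number of indices attaining $M$, which is nonzero modulo $p$; so $M = \deg F$ and the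
  solutions are bounded. If $n \ge p$, start from powers of $t$ as $x_i$, such that $x_i A_i$ has
  degree $M$ for $i \le p$ and $M - 1$ for $i > p$. The $p$ leading terms cancel, so the error
  $F - \sum x_i A_i$ has degree below $M$. Bezout coefficients of the error, all but the first
  reduced modulo $A_1$, correct the $x_i$ without affecting their leading terms.
\<close>

section \<open>Bezout identities for jointly coprime families\<close>

lemma bezout_family:
  fixes A :: "'i \<Rightarrow> 'a::field poly"
  assumes fin: "finite S" and nz: "j \<in> S" "A j \<noteq> 0"
    and cop: "\<And>d. (\<And>i. i \<in> S \<Longrightarrow> d dvd A i) \<Longrightarrow> is_unit d"
  obtains b where "(\<Sum>i\<in>S. b i * A i) = 1"
proof -
  \<comment> \<open>\<open>I\<close> is the ideal generated by the family; as in any Euclidean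
    domain, a nonzero element of least degree generates it.\<close>
  define I where "I = {f. \<exists>b. f = (\<Sum>i\<in>S. b i * A i)}"
  have AI: "A i \<in> I" if "i \<in> S" for i
  proof -
    have "(\<Sum>k\<in>S. (if k = i then 1 else 0) * A k) = (\<Sum>k\<in>S. if k = i then A k else 0)"
      by (rule sum.cong) auto
    then have "A i = (\<Sum>k\<in>S. (if k = i then 1 else 0) * A k)"
      using that fin by simp
    then show ?thesis
      unfolding I_def by (intro CollectI exI[of _ "\<lambda>k. if k = i then 1 else 0"])
  qed
  have lin: "f - q * g \<in> I" if fI: "f \<in> I" and gI: "g \<in> I" for f g q
  proof -
    obtain b c where "f = (\<Sum>i\<in>S. b i * A i)" "g = (\<Sum>i\<in>S. c i * A i)"
      using fI gI unfolding I_def by blast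
    then have "f - q * g = (\<Sum>i\<in>S. (b i - q * c i) * A i)"
      by (simp add: algebra_simps sum_subtractf sum_distrib_left)
    then show ?thesis
      unfolding I_def by (intro CollectI exI[of _ "\<lambda>i. b i - q * c i"])
  qed
  obtain d where d: "d \<in> I" "d \<noteq> 0"
    and min: "\<And>f. f \<in> I \<Longrightarrow> f \<noteq> 0 \<Longrightarrow> degree d \<le> degree f"
    using ex_has_least_nat[of "\<lambda>f. f \<in> I \<and> f \<noteq> 0" "A j" degree] AI nz by auto
  have "d dvd A i" if "i \<in> S" for i
  proof -
    have "A i mod d \<in> I"
      using lin[OF AI[OF that] d(1), of "A i div d"] by (simp add: minus_div_mult_eq_mod)
    \<comment> \<open>A nonzero remainder would be an element of \<open>I\<close> of degree below
      that of \<open>d\<close>.\<close>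
    then have "A i mod d = 0"
      using min degree_mod_less[OF d(2), of "A i"] by (meson not_le)
    then show ?thesis
      by (simp add: mod_eq_0_iff_dvd)
  qed
  then have "is_unit d"
    using cop by blast
  then obtain e where e: "1 = d * e"
    by (elim dvdE)
  obtain b where "d = (\<Sum>i\<in>S. b i * A i)"
    using d(1) unfolding I_def by blast
  then have "(\<Sum>i\<in>S. (e * b i) * A i) = 1"
    using e by (simp add: sum_distrib_left sum_distrib_right mult_ac)
  then show ?thesis
    by (rule that)
qed

text \<open>Reducing every coefficient but the \<open>j\<close>-th modulo \<open>A j\<close> makes
  all other terms small. The \<open>j\<close>-th product is then the difference of \<open>G\<close>
  and small terms, so it is bounded by \<open>M\<close> as well.\<close>

lemma bezout_family_reduced:
  fixes A :: "'i \<Rightarrow> 'a::field poly"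
  assumes fin: "finite S" and j: "j \<in> S" "A j \<noteq> 0"
    and cop: "\<And>d. (\<And>i. i \<in> S \<Longrightarrow> d dvd A i) \<Longrightarrow> is_unit d"
    and G: "degree G < M" and M: "\<And>i. i \<in> S \<Longrightarrow> degree (A j) + degree (A i) < M"
  obtains y where "(\<Sum>i\<in>S. y i * A i) = G"
    and "\<And>i. i \<in> S - {j} \<Longrightarrow> degree (y i) \<le> degree (A j)"
    and "degree (y j * A j) < M"
proof -
  obtain b where b: "(\<Sum>i\<in>S. b i * A i) = 1"
    using bezout_family[of S j A, OF fin j cop] by blast
  define c where "c i = G * b i" for i
  \<comment> \<open>The quotient part of \<open>c k * A k\<close> is a multiple of
    \<open>A j\<close>, so it can be moved into the coefficient of \<open>A j\<close>.\<close>
  define y where "y i = (if i = j then c j + (\<Sum>k\<in>S-{j}. (c k div A j) * A k) else c i mod A j)" for i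
  have rest: "(\<Sum>i\<in>S-{j}. y i * A i) = (\<Sum>i\<in>S-{j}. (c i mod A j) * A i)"
    by (rule sum.cong) (auto simp: y_def)
  have split_c: "c i * A i = (c i div A j) * A i * A j + (c i mod A j) * A i" for i
  proof -
    have "c i * A i = (c i div A j * A j + c i mod A j) * A i"
      by simp
    then show ?thesis
      by (simp only: distrib_left distrib_right mult_ac)
  qed
  have "G = G * (\<Sum>i\<in>S. b i * A i)"
    by (simp add: b)
  also have "\<dots> = (\<Sum>i\<in>S. c i * A i)"
    by (simp add: c_def sum_distrib_left mult.assoc)
  also have "\<dots> = c j * A j + (\<Sum>i\<in>S-{j}. c i * A i)"
    using fin j by (simp add: sum.remove)
  also have "(\<Sum>i\<in>S-{j}. c i * A i) =
      (\<Sum>i\<in>S-{j}. (c i div A j) * A i * A j + (c i mod A j) * A i)"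
    by (rule sum.cong) (simp_all add: split_c)
  also have "\<dots> = (\<Sum>i\<in>S-{j}. (c i div A j) * A i) * A j + (\<Sum>i\<in>S-{j}. y i * A i)"
    by (simp add: sum.distrib sum_distrib_right rest)
  finally have split: "G = y j * A j + (\<Sum>i\<in>S-{j}. y i * A i)"
    by (simp add: y_def algebra_simps)
  \<comment> \<open>The bound is not strict: if \<open>A j\<close> is constant, the remainder 0 and
    \<open>A j\<close> both have degree 0.\<close>
  have small: "degree (y i) \<le> degree (A j)" if "i \<in> S - {j}" for i
    using that degree_mod_less[OF j(2), of "c i"] by (auto simp: y_def)
  have "degree (\<Sum>i\<in>S-{j}. y i * A i) < M"
  proof (rule degree_sum_less)
    show "0 < M"
      using G by simp
    show "degree (y i * A i) < M" if "i \<in> S - {j}" for i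
      using degree_mult_le[of "y i" "A i"] small[OF that] M[of i] that by auto
  qed
  then have "degree (G - (\<Sum>i\<in>S-{j}. y i * A i)) < M"
    using G by (rule degree_diff_less[rotated])
  then have "degree (y j * A j) < M"
    using split by simp
  moreover have "(\<Sum>i\<in>S. y i * A i) = G"
    using split fin j by (simp add: sum.remove)
  ultimately show ?thesis
    using that small by blast
qed

section \<open>Monic polynomials and leading terms of sums\<close>

lemma monic_mult: "monic f \<Longrightarrow> monic g \<Longrightarrow> monic (f * g)"
  by (simp add: monic_def lead_coeff_mult)

lemma monic_nonzero: "monic f \<Longrightarrow> f \<noteq> 0"
  by (auto simp: monic_def)

lemma monic_add_lower:
  assumes "monic f" "degree g < degree f"
  shows "monic (f + g)" "degree (f + g) = degree f"
  using assms by (simp_all add: monic_def degree_add_eq_left coeff_eq_0)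

text \<open>Fewer than \<open>CHAR('a)\<close> leading coefficients 1 cannot add up to 0, so the top
  terms never cancel.\<close>

lemma degree_sum_nonneg:
  fixes g :: "'i \<Rightarrow> 'a::field poly"
  assumes fin: "finite S" and card: "card S < CHAR('a)"
    and g: "\<And>i. i \<in> S \<Longrightarrow> g i \<in> nonneg_polys" and i: "i \<in> S"
  shows "degree (g i) \<le> degree (\<Sum>k\<in>S. g k)"
proof (cases "\<exists>k\<in>S. g k \<noteq> 0")
  case False
  then show ?thesis
    using i by simp
next
  case True
  \<comment> \<open>Zero entries are excluded because they too have degree 0: for
    \<open>M = 0\<close> they would be counted in \<open>U\<close> without contributing a
    coefficient 1.\<close>
  define T where "T = {k\<in>S. g k \<noteq> 0}"
  have T: "finite T" "T \<noteq> {}"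
    using fin True by (auto simp: T_def)
  define M where "M = Max ((\<lambda>k. degree (g k)) ` T)"
  have le: "degree (g k) \<le> M" if "k \<in> T" for k
    using T that by (simp add: M_def)
  have "M \<in> (\<lambda>k. degree (g k)) ` T"
    unfolding M_def using T by (intro Max_in) auto
  then obtain m where m: "m \<in> T" "degree (g m) = M"
    by auto
  define U where "U = {k\<in>T. degree (g k) = M}"
  have "coeff (\<Sum>k\<in>S. g k) M = (\<Sum>k\<in>S. if k \<in> U then 1 else 0)"
    unfolding coeff_sum
  proof (rule sum.cong)
    fix k assume k: "k \<in> S"
    show "coeff (g k) M = (if k \<in> U then 1 else 0)"
    proof (cases "g k = 0")
      case False
      then have "monic (g k)" "degree (g k) \<le> M"
        using g[OF k] le[of k] k by (auto simp: nonneg_polys_def T_def)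
      then show ?thesis
        using k False by (cases "degree (g k) = M") (auto simp: U_def T_def monic_def coeff_eq_0)
    qed (auto simp: U_def T_def)
  qed simp
  also have "\<dots> = of_nat (card U)"
  proof -
    have "S \<inter> U = U"
      by (auto simp: U_def T_def)
    then show ?thesis
      using fin by (simp add: sum.If_cases)
  qed
  also have "\<dots> \<noteq> 0"
  proof -
    have "U \<subseteq> S" "m \<in> U"
      using m by (auto simp: U_def T_def)
    then have "0 < card U" "card U \<le> card S"
      using fin by (auto simp: card_gt_0_iff finite_subset card_mono)
    then show ?thesis
      using card by (auto simp: of_nat_eq_0_iff_char_dvd dest: dvd_imp_le)
  qed
  finally have "M \<le> degree (\<Sum>k\<in>S. g k)"
    by (rule le_degree)
  then show ?thesis
    using le[of i] i by (cases "g i = 0") (auto simp: T_def)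
qed

section \<open>Necessity and sufficiency of \<open>n \<ge> p\<close>\<close>

lemma coprime_family_pos: "coprime_family n A \<Longrightarrow> 0 < n"
  \<comment> \<open>For \<open>n = 0\<close> the divisibility condition is vacuous, so
    \<open>d = 0\<close> would have to be a unit.\<close>
  by (rule ccontr) (auto simp: coprime_family_def dest: spec[of _ 0])

lemma max_imp_ge_char:
  fixes A :: "nat \<Rightarrow> 'a::field poly"
  assumes A: "\<And>i. i \<in> {1..n} \<Longrightarrow> monic (A i)"
    and large: "arbitrarily_large_max n A F"
  shows "CHAR('a) \<le> n"
proof (rule ccontr)
  assume "\<not> CHAR('a) \<le> n"
  then have card: "card {1..n} < CHAR('a)"
    by simp
  \<comment> \<open>The bound exceeds \<open>degree F\<close> and is positive, which also ensures
    \<open>x i \<noteq> 0\<close>, so that degrees add in \<open>x i * A i\<close>.\<close>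
  obtain x i where x: "solution n A F x" and i: "i \<in> {1..n}" "Suc (degree F) \<le> degree (x i)"
    using large unfolding arbitrarily_large_max_def by blast
  have "x k * A k \<in> nonneg_polys" if "k \<in> {1..n}" for k
  proof -
    have "monic (x k) \<or> x k = 0"
      using x that by (auto simp: solution_def nonneg_polys_def)
    then show ?thesis
      using monic_mult[OF _ A[OF that]] by (auto simp: nonneg_polys_def)
  qed
  then have "degree (x i * A i) \<le> degree F"
    using degree_sum_nonneg[of "{1..n}" "\<lambda>k. x k * A k" i] card i(1) x by (simp add: solution_def)
  moreover have "degree (x i * A i) = degree (x i) + degree (A i)"
    using i monic_nonzero[OF A[OF i(1)]] by (intro degree_mult_eq) auto
  ultimately show False
    using i(2) by simp
qed

lemma ge_char_imp_all:
  fixes A :: "nat \<Rightarrow> 'a::field poly"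
  assumes p: "CHAR('a) > 0" and A: "\<And>i. i \<in> {1..n} \<Longrightarrow> monic (A i)"
    and cop: "coprime_family n A" and n: "CHAR('a) \<le> n"
  shows "arbitrarily_large_all n A F"
  unfolding arbitrarily_large_all_def
proof
  fix N
  define p where "p = CHAR('a)"
  have one: "1 \<in> {1..n}"
    using coprime_family_pos[OF cop] by auto
  define D where "D = (\<Sum>i=1..n. degree (A i))"
  have D: "degree (A i) \<le> D" if "i \<in> {1..n}" for i
    unfolding D_def using that by (intro member_le_sum) auto
  \<comment> \<open>Large enough that \<open>M\<close> exceeds \<open>degree F\<close> and every
    \<open>degree (A 1) + degree (A i)\<close>, and that, even at height \<open>M - 1\<close>, each
    \<open>x0 i\<close> has degree at least \<open>N\<close> and above
    \<open>degree (A 1)\<close>.\<close>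
  define M where "M = degree F + 2 * D + N + 3"
  \<comment> \<open>Exactly \<open>p\<close> products reach degree \<open>M\<close>, so their
    leading coefficients sum to \<open>p = 0\<close> in the field; the others stay one degree
    lower.\<close>
  define h where "h i = (if i \<le> p then M else M - 1)" for i
  define x0 where "x0 i = monom (1::'a) (h i - degree (A i))" for i
  have hM: "degree F + 2 * D + N + 2 \<le> h i" "h i \<le> M" for i
    by (auto simp: h_def M_def)
  have x0: "monic (x0 i)" "degree (x0 i) = h i - degree (A i)" for i
    by (simp_all add: x0_def monic_def degree_monom_eq)
  have deg: "degree (x0 i * A i) = h i" if "i \<in> {1..n}" for i
    using D[OF that] hM(1)[of i] x0[of i] monic_nonzero[OF x0(1)] monic_nonzero[OF A[OF that]]
    by (simp add: degree_mult_eq)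
  define E where "E = (\<Sum>i=1..n. x0 i * A i)"
  have "degree E \<le> M"
    unfolding E_def using deg hM(2) by (intro degree_sum_le) auto
  moreover have "coeff E M = 0"
  proof -
    have "coeff E M = (\<Sum>i=1..n. if i \<le> p then 1 else 0)"
      unfolding E_def coeff_sum
    proof (rule sum.cong)
      fix i assume i: "i \<in> {1..n}"
      have "monic (x0 i * A i)"
        using x0 A[OF i] by (intro monic_mult)
      then show "coeff (x0 i * A i) M = (if i \<le> p then 1 else 0)"
        using deg[OF i] by (auto simp: h_def monic_def M_def intro!: coeff_eq_0)
    qed simp
    also have "\<dots> = of_nat (card ({1..n} \<inter> {i. i \<le> p}))"
      by (simp add: sum.If_cases)
    also have "{1..n} \<inter> {i. i \<le> p} = {1..p}"
      using n by (auto simp: p_def)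
    finally show ?thesis
      by (simp add: p_def)
  qed
  \<comment> \<open>\<open>M > 0\<close> matters here: it covers \<open>E = 0\<close>, whose degree
    is 0.\<close>
  ultimately have "degree E < M"
    using leading_coeff_0_iff[of E] by (cases "degree E = M") (auto simp: M_def)
  then have G: "degree (F - E) < M"
    by (intro degree_diff_less) (simp_all add: M_def)
  obtain y where y: "(\<Sum>i=1..n. y i * A i) = F - E"
    and y_small: "\<And>i. i \<in> {1..n} - {1} \<Longrightarrow> degree (y i) \<le> degree (A 1)"
    and y_one: "degree (y 1 * A 1) < M"
  proof (rule bezout_family_reduced[of "{1..n}" 1 A "F - E" M])
    show "A 1 \<noteq> 0"
      using A[OF one] by (rule monic_nonzero)
    show "is_unit d" if "\<And>i. i \<in> {1..n} \<Longrightarrow> d dvd A i" for d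
      using cop that unfolding coprime_family_def by blast
    show "degree (A 1) + degree (A i) < M" if "i \<in> {1..n}" for i
      using D[OF one] D[OF that] by (simp add: M_def)
  qed (use one G in auto)
  have lower: "degree (y i) < degree (x0 i)" if i: "i \<in> {1..n}" for i
  proof (cases "i = 1")
    case True
    \<comment> \<open>The correction \<open>y 1 * A 1\<close> is only known to have degree below
      \<open>M\<close>, so index 1 must start at full height; it does since
      \<open>p \<ge> 1\<close>.\<close>
    have "h 1 = M"
      using p by (simp add: h_def p_def)
    moreover have "degree (y 1) + degree (A 1) < M" if "y 1 \<noteq> 0"
      using y_one that monic_nonzero[OF A[OF one]] by (simp add: degree_mult_eq)
    ultimately show ?thesis
      using True x0(2)[of 1] D[OF one] by (cases "y 1 = 0") (auto simp: M_def)
  next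
    case False
    then show ?thesis
      using y_small[of i] i D[OF one] D[OF i] x0(2)[of i] hM(1)[of i] by auto
  qed
  have "solution n A F (\<lambda>i. x0 i + y i)"
    unfolding solution_def
  proof
    show "\<forall>i\<in>{1..n}. x0 i + y i \<in> nonneg_polys"
      using monic_add_lower(1)[OF x0(1) lower] by (simp add: nonneg_polys_def)
    show "(\<Sum>i=1..n. (x0 i + y i) * A i) = F"
      using y by (simp add: distrib_right sum.distrib E_def)
  qed
  moreover have "N \<le> degree (x0 i + y i)" if i: "i \<in> {1..n}" for i
    using monic_add_lower(2)[OF x0(1) lower[OF i]] x0(2)[of i] hM(1)[of i] D[OF i] by simp
  ultimately show "\<exists>x. solution n A F x \<and> (\<forall>i\<in>{1..n}. N \<le> degree (x i))"
    by blast
qed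

theorem theorem3p1:
  fixes A :: "nat \<Rightarrow> 'a::field poly" and F :: "'a poly" and n p :: nat
  assumes "CHAR('a) = p" and "p > 0"
    and "\<And>i. i \<in> {1..n} \<Longrightarrow> monic (A i)"
    and "coprime_family n A"
    and "monic F"
  shows "(arbitrarily_large_all n A F \<longleftrightarrow> n \<ge> p) \<and> (arbitrarily_large_max n A F \<longleftrightarrow> n \<ge> p)"
proof -
  \<comment> \<open>A nonempty index set lets the strong reading imply the weak one; this closes the
    cycle strong, weak, \<open>p \<le> n\<close>, strong, which gives both equivalences.\<close>
  have "1 \<in> {1..n}"
    using coprime_family_pos[OF assms(4)] by auto
  then have "arbitrarily_large_max n A F" if "arbitrarily_large_all n A F"
    using that unfolding arbitrarily_large_all_def arbitrarily_large_max_def by blast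
  moreover have "p \<le> n" if "arbitrarily_large_max n A F"
    using max_imp_ge_char[OF assms(3) that] assms(1) by simp
  moreover have "arbitrarily_large_all n A F" if "p \<le> n"
    using ge_char_imp_all[of n A F] assms that by simp
  ultimately show ?thesis
    by blast
qed

end
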